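(* Let $p\in[0,1]$, let $G=(V,E)$ be a finite graph with edge weights $w:E\to\mathbb{R}_{\ge0}$, and let $E'\subseteq E$ be a random subset such that each $e\in E$ is in $E'$ independently with probability $p$. Then $$\mathrm{E}\big[\mathrm{Greedy}(G[E'])\big]\ \ge\ \min\{p,1/2\}\cdot\mathrm{OPT}(G).$$ Moreover, there is a sequence of edge-weighted (bipartite) graphs $G_1,G_2,\dots$ on which $\mathrm{E}[\mathrm{Greedy}(G_k[E'])]/\mathrm{OPT}(G_k)$ approaches $\min\{p,1/2\}$ as $k\to\infty$.
   Context: Ties between edge weights are broken by a fixed consistent rule, so edge weights are totally ordered. $G[E']$ is the subgraph of $G$ with edge set $E'$. $\mathrm{Greedy}(K)$ is the weight of the matching obtained by processing the edges of $K$ in non-increasing order of weight, adding an edge iff neither endpoint is already covered. $\mathrm{OPT}(G)$ is the maximum weight of a matching in $G$. *)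

theory Defs
  imports "HOL-Probability.Probability"
begin

definition finite_graph :: "'a set \<Rightarrow> 'a set set \<Rightarrow> bool" where
  "finite_graph V E \<longleftrightarrow> finite V \<and> (\<forall>e\<in>E. e \<subseteq> V \<and> card e = 2)"

definition bipartite :: "'a set \<Rightarrow> 'a set set \<Rightarrow> bool" where
  "bipartite V E \<longleftrightarrow>
     (\<exists>X Y. X \<union> Y = V \<and> X \<inter> Y = {} \<and> (\<forall>e\<in>E. \<exists>x\<in>X. \<exists>y\<in>Y. e = {x, y}))"

definition matching :: "'a set set \<Rightarrow> 'a set set \<Rightarrow> bool" where
  "matching E M \<longleftrightarrow> M \<subseteq> E \<and> pairwise disjnt M"

text \<open>Isolated vertices affect neither matchings nor the greedy algorithm, so the maximum
  matching weight, the greedy algorithm and the subgraph \<open>G[E']\<close> are given by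
  edge sets alone.\<close>

definition OPT :: "('a set \<Rightarrow> real) \<Rightarrow> 'a set set \<Rightarrow> real" where
  "OPT w E = Max {sum w M | M. matching E M}"

text \<open>A tie-breaking rule is a linear order \<open>r\<close> on the edges; among edges of equal weight,
  the \<open>r\<close>-smaller one is processed first. The same \<open>r\<close> is used for all subgraphs.\<close>

definition precedes :: "('a set \<Rightarrow> real) \<Rightarrow> 'a set rel \<Rightarrow> 'a set \<Rightarrow> 'a set \<Rightarrow> bool" where
  "precedes w r e f \<longleftrightarrow> w e > w f \<or> w e = w f \<and> (e, f) \<in> r"

definition processing_order :: "('a set \<Rightarrow> real) \<Rightarrow> 'a set rel \<Rightarrow> 'a set set \<Rightarrow> 'a set list" where
  "processing_order w r K =
     (THE es. set es = K \<and> distinct es \<and> sorted_wrt (precedes w r) es)"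

lemma processing_order_ex1:
  assumes "finite E" "linear_order_on E r" "K \<subseteq> E"
  shows "\<exists>!es. set es = K \<and> distinct es \<and> sorted_wrt (precedes w r) es"
proof -
  let ?P = "\<lambda>K es. set es = K \<and> distinct es \<and> sorted_wrt (precedes w r) es"
  from assms(2) have r: "trans r" "antisym r" "total_on E r"
    by (auto simp: linear_order_on_def partial_order_on_def preorder_on_def)
  have tr: "precedes w r e g" if "precedes w r e f" "precedes w r f g" for e f g
    using that r(1) by (auto simp: precedes_def dest: transD)
  have asym: "e = f" if "precedes w r e f" "precedes w r f e" for e f
    using that r(2) by (auto simp: precedes_def dest: antisymD)
  have tot: "precedes w r e f \<or> precedes w r f e" if "e \<in> E" "f \<in> E" "e \<noteq> f" for e f
    using that r(3) by (auto simp: precedes_def total_on_def)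
  have "finite K" using assms finite_subset by blast
  then have ex: "\<exists>es. ?P K es" using assms(3)
  proof (induction K)
    case empty
    then show ?case by simp
  next
    case (insert x K)
    then obtain es where es: "?P K es" by auto
    let ?es = "filter (\<lambda>f. precedes w r f x) es @ x # filter (\<lambda>f. \<not> precedes w r f x) es"
    have after: "precedes w r x g" if "g \<in> set es" "\<not> precedes w r g x" for g
      using that es insert.hyps insert.prems tot[of x g] by blast
    moreover have "precedes w r f g"
      if "precedes w r f x" "g \<in> set es" "\<not> precedes w r g x" for f g
      using tr[OF that(1) after[OF that(2,3)]] .
    ultimately have "sorted_wrt (precedes w r) ?es"
      using es unfolding sorted_wrt_append by (simp add: sorted_wrt_filter)
    moreover have "set ?es = insert x K" "distinct ?es" using es insert.hyps(2) by auto
    ultimately have "?P (insert x K) ?es" by blast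
    then show ?case by blast
  qed
  have uniq: "es = fs" if "?P K es" "?P K fs" for K es fs
    using that
  proof (induction es arbitrary: K fs)
    case Nil
    then show ?case by auto
  next
    case (Cons e es)
    then obtain f fs' where fs: "fs = f # fs'" by (cases fs) auto
    have "e = f"
    proof (rule ccontr)
      assume "e \<noteq> f"
      moreover have "set (e # es) = set (f # fs')" using Cons.prems fs by metis
      ultimately have "e \<in> set fs'" "f \<in> set es" by (metis set_ConsD list.set_intros(1))+
      then have "precedes w r e f" "precedes w r f e" using Cons.prems fs by simp_all
      then show False using asym \<open>e \<noteq> f\<close> by blast
    qed
    moreover have "insert e (set es) = insert f (set fs')" using Cons.prems fs
      by (metis list.simps(15))
    moreover have "e \<notin> set es" "f \<notin> set fs'" using Cons.prems fs by simp_all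
    ultimately have "set fs' = set es" by (metis insert_ident)
    moreover have "distinct es" "sorted_wrt (precedes w r) es"
      "distinct fs'" "sorted_wrt (precedes w r) fs'" using Cons.prems fs by simp_all
    ultimately have "es = fs'" by (intro Cons.IH[of "set es"] conjI refl)
    then show ?case using fs \<open>e = f\<close> by simp
  qed
  show ?thesis by (rule ex_ex1I[OF ex uniq])
qed

definition greedy_matching :: "'a set list \<Rightarrow> 'a set set" where
  "greedy_matching es = fold (\<lambda>e M. if e \<inter> \<Union>M = {} then insert e M else M) es {}"

definition Greedy :: "('a set \<Rightarrow> real) \<Rightarrow> 'a set rel \<Rightarrow> 'a set set \<Rightarrow> real" where
  "Greedy w r K = sum w (greedy_matching (processing_order w r K))"

definition random_subset :: "real \<Rightarrow> 'b set \<Rightarrow> 'b set pmf" where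
  "random_subset p E =
     map_pmf (\<lambda>X. {e \<in> E. X e}) (Pi_pmf E False (\<lambda>_. bernoulli_pmf p))"

end

theory Submission imports Defs begin

text \<open>Lower bound: every selected edge \<open>f\<close> gives half of its weight to each of its two endpoints, and an
  edge \<open>e\<close> of an optimal matching collects what its endpoints receive. Condition on \<open>E' - {e}\<close>. If
  the edges before \<open>e\<close> already cover an endpoint of \<open>e\<close>, then \<open>e\<close> collects at least \<open>w e / 2\<close>;
  otherwise \<open>e\<close> itself is selected with probability \<open>p\<close>, and collects \<open>w e\<close>.

  Tightness: for \<open>p \<le> 1/2\<close> a single edge suffices. For \<open>p > 1/2\<close> take a complete bipartite graph
  on \<open>n + n\<close> vertices with weights slightly above \<open>1\<close> and attach a pendant edge of weight \<open>1\<close> to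
  every vertex; the optimum is at least \<open>2n\<close>. The greedy matching is maximal on the random subgraph
  of the heavy part, so the vertices that it leaves uncovered there span no sampled edge, and by a
  union bound only \<open>O(\<surd>n)\<close> of them are expected on each side.\<close>


section \<open>Random edge subsets\<close>

lemma set_pmf_random_subset: "set_pmf (random_subset p E) \<subseteq> Pow E"
  by (auto simp: random_subset_def)

lemma finite_set_pmf_random_subset [simp]: "finite E \<Longrightarrow> finite (set_pmf (random_subset p E))"
  by (rule finite_subset[OF set_pmf_random_subset]) simp

lemma integrable_random_subset [simp]:
  fixes f :: "'b set \<Rightarrow> real"
  shows "finite E \<Longrightarrow> integrable (measure_pmf (random_subset p E)) f"
  by (simp add: integrable_measure_pmf_finite)

lemma random_subset_expectation_mono:
  fixes f g :: "'b set \<Rightarrow> real"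
  assumes "finite E" "\<And>X. X \<subseteq> E \<Longrightarrow> f X \<le> g X"
  shows "measure_pmf.expectation (random_subset p E) f
           \<le> measure_pmf.expectation (random_subset p E) g"
  using assms set_pmf_random_subset[of p E]
  by (intro integral_mono_AE) (auto simp: AE_measure_pmf_iff)

lemma random_subset_insert:
  assumes "finite E" "e \<notin> E"
  shows "random_subset p (insert e E) =
    bernoulli_pmf p \<bind> (\<lambda>b. map_pmf (\<lambda>X. if b then insert e X else X) (random_subset p E))"
proof -
  have "{x. (x = e \<or> x \<in> E) \<and> (if x = e then b else f x)} =
      (if b then insert e {x \<in> E. f x} else {x \<in> E. f x})" for b f
    using assms(2) by auto
  then show ?thesis
    using assms
    by (simp add: random_subset_def Pi_pmf_insert' map_pmf_def bind_assoc_pmf bind_return_pmf)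
qed

text \<open>The coin of \<open>e\<close> is independent of the rest of the sample. Thus a pointwise
  bound on the average over this one coin passes to the expectation.\<close>

lemma random_subset_expectation_insert:
  fixes f :: "'b set \<Rightarrow> real"
  assumes "finite E" "e \<notin> E" "0 \<le> p" "p \<le> 1"
  shows "measure_pmf.expectation (random_subset p (insert e E)) f =
    measure_pmf.expectation (random_subset p E) (\<lambda>X. p * f (insert e X) + (1 - p) * f X)"
proof -
  have "measure_pmf.expectation (random_subset p (insert e E)) f =
      p * measure_pmf.expectation (random_subset p E) (\<lambda>X. f (insert e X)) +
      (1 - p) * measure_pmf.expectation (random_subset p E) f"
    unfolding random_subset_insert[OF assms(1,2)]
    by (subst pmf_expectation_bind[of UNIV]) (use assms in \<open>auto simp: UNIV_bool\<close>)
  then show ?thesis using assms(1) by simp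
qed

lemma prob_random_subset_disjoint:
  assumes "finite E" "F \<subseteq> E" "0 \<le> p" "p \<le> 1"
  shows "measure_pmf.prob (random_subset p E) {X. X \<inter> F = {}} = (1 - p) ^ card F"
proof -
  \<comment> \<open>Coordinatewise the event is a box: the edges of \<open>F\<close> must be absent
    and the others are free, so its probability is a product over \<open>E\<close>.\<close>
  let ?B = "\<lambda>e. if e \<in> F then {False} else UNIV"
  have "measure_pmf.prob (random_subset p E) {X. X \<inter> F = {}} =
      measure_pmf.prob (Pi_pmf E False (\<lambda>_. bernoulli_pmf p)) (Pi E ?B)"
    using assms(2) unfolding random_subset_def measure_map_pmf
    by (intro arg_cong2[where f=measure] refl) (auto simp: Pi_def)
  also have "\<dots> = (\<Prod>e\<in>E. if e \<in> F then 1 - p else 1)"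
    using assms(1,3,4) by (simp add: measure_Pi_pmf_Pi measure_pmf_single if_distrib cong: if_cong)
  also have "\<dots> = (1 - p) ^ card F"
    using assms(1,2) by (simp add: prod.If_cases Int_absorb1)
  finally show ?thesis .
qed

section \<open>The greedy matching\<close>

lemma greedy_matching_Nil [simp]: "greedy_matching [] = {}"
  by (simp add: greedy_matching_def)

lemma greedy_matching_snoc:
  "greedy_matching (es @ [e]) =
    (if e \<inter> \<Union>(greedy_matching es) = {} then insert e (greedy_matching es)
     else greedy_matching es)"
  by (simp add: greedy_matching_def)

lemma greedy_matching_append_mono: "greedy_matching es \<subseteq> greedy_matching (es @ fs)"
proof (induction fs rule: rev_induct)
  case (snoc f fs)
  then show ?case using greedy_matching_snoc[of "es @ fs" f] by auto
qed simp

lemma matching_greedy_matching: "matching (set es) (greedy_matching es)"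
proof (induction es rule: rev_induct)
  case Nil
  then show ?case by (simp add: matching_def)
next
  case (snoc e es)
  then show ?case
    by (auto simp: matching_def greedy_matching_snoc pairwise_insert disjnt_def)
qed

lemma processing_order:
  assumes "finite E" "linear_order_on E r" "K \<subseteq> E"
  shows "set (processing_order w r K) = K" "distinct (processing_order w r K)"
    "sorted_wrt (precedes w r) (processing_order w r K)"
  using theI'[OF processing_order_ex1[OF assms, of w]] unfolding processing_order_def by auto

lemma processing_order_eqI:
  assumes "finite E" "linear_order_on E r" "K \<subseteq> E"
    and "set es = K" "distinct es" "sorted_wrt (precedes w r) es"
  shows "processing_order w r K = es"
  using processing_order[OF assms(1-3), of w] processing_order_ex1[OF assms(1-3), of w] assms(4-6)
  by blast

text \<open>The runs with and without \<open>e\<close> agree until \<open>e\<close> is reached, and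
  chosen edges are never dropped. If \<open>e\<close> is free at that moment, it is chosen;
  otherwise it is blocked by an edge chosen from the common prefix, which stays in both
  results.\<close>

lemma greedy_dichotomy:
  fixes w :: "'a set \<Rightarrow> real"
  assumes "finite E" "linear_order_on E r" "insert e X \<subseteq> E" "e \<notin> X"
  defines "G \<equiv> \<lambda>K. greedy_matching (processing_order w r K)"
  shows "e \<in> G (insert e X) \<or>
    (\<exists>f \<in> G (insert e X) \<inter> G X. f \<inter> e \<noteq> {} \<and> precedes w r f e)"
proof -
  define es where "es = processing_order w r (insert e X)"
  note es = processing_order[OF assms(1-3), of w, folded es_def]
  from es(1) obtain xs ys where split: "es = xs @ e # ys" by (metis insertI1 split_list)
  \<comment> \<open>Deleting \<open>e\<close> from the sorted list leaves a sorted list of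
    \<open>X\<close>. By uniqueness this is the processing order of \<open>X\<close>, so both runs
    start with \<open>xs\<close>.\<close>
  have X: "processing_order w r X = xs @ ys"
    using assms(3,4) es unfolding split
    by (intro processing_order_eqI[OF assms(1,2)]) (auto simp: sorted_wrt_append)
  have sub: "greedy_matching xs \<subseteq> G (insert e X)" "greedy_matching xs \<subseteq> G X"
    using greedy_matching_append_mono[of xs ys] greedy_matching_append_mono[of xs "e # ys"]
    unfolding G_def X es_def[symmetric] split by auto
  show ?thesis
  proof (cases "e \<inter> \<Union>(greedy_matching xs) = {}")
    case True
    then have "e \<in> greedy_matching ((xs @ [e]) @ ys)"
      using greedy_matching_append_mono[of "xs @ [e]" ys] by (auto simp: greedy_matching_snoc)
    then show ?thesis using es_def split by (simp add: G_def)
  next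
    case False
    then obtain f where f: "f \<in> greedy_matching xs" "f \<inter> e \<noteq> {}" by auto
    then have "f \<in> set xs" using matching_greedy_matching[of xs] by (auto simp: matching_def)
    then have "precedes w r f e" using es(3) split by (auto simp: sorted_wrt_append)
    then show ?thesis using f sub by auto
  qed
qed

text \<open>This is the dichotomy for \<open>X = K - {e}\<close>. That the blocking edge precedes
  \<open>e\<close> matters for tightness, where a heavy edge can be blocked only by a heavy
  edge.\<close>

lemma greedy_maximal:
  assumes "finite E" "linear_order_on E r" "K \<subseteq> E" "e \<in> K"
  shows "e \<in> greedy_matching (processing_order w r K) \<or>
    (\<exists>f \<in> greedy_matching (processing_order w r K). f \<inter> e \<noteq> {} \<and> precedes w r f e)"
  using greedy_dichotomy[OF assms(1,2), of e "K - {e}" w] assms(3,4) by (auto simp: insert_absorb)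

lemma matching_greedy:
  assumes "finite E" "linear_order_on E r" "K \<subseteq> E"
  shows "matching K (greedy_matching (processing_order w r K))"
  using matching_greedy_matching processing_order(1)[OF assms] by metis

section \<open>Charging the greedy weight to disjoint edges\<close>

text \<open>For two-element edges the factor \<open>card (f \<inter> e) / 2\<close> is the share of
  the endpoints of \<open>f\<close> that lie in \<open>e\<close>: 1 if \<open>f = e\<close>, and 1/2
  for a single common vertex.\<close>

definition charge :: "('a set \<Rightarrow> real) \<Rightarrow> 'a set set \<Rightarrow> 'a set \<Rightarrow> real" where
  "charge w G e = (\<Sum>f\<in>G. w f * card (f \<inter> e) / 2)"

lemma charge_ge:
  fixes w :: "'a set \<Rightarrow> real"
  assumes "finite G" "\<forall>f\<in>G. 0 \<le> w f" "f \<in> G"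
  shows "w f * card (f \<inter> e) / 2 \<le> charge w G e"
  unfolding charge_def using assms by (intro member_le_sum) auto

lemma charge_nonneg: "\<forall>f\<in>G. 0 \<le> w f \<Longrightarrow> 0 \<le> charge w G e"
  unfolding charge_def by (intro sum_nonneg) auto

text \<open>Disjoint edges share no vertex, so each of the two endpoints of \<open>f\<close> pays at
  most one edge of \<open>M\<close>, and \<open>f\<close> hands out no more than its own
  weight.\<close>

lemma sum_charge_le:
  assumes "finite G" "finite M" "pairwise disjnt M" "\<forall>f\<in>G. 0 \<le> w f \<and> card f = 2"
  shows "(\<Sum>e\<in>M. charge w G e) \<le> sum w G"
proof -
  have *: "(\<Sum>e\<in>M. card (f \<inter> e)) \<le> 2" if "f \<in> G" for f
  proof -
    \<comment> \<open>Infinite sets have \<open>card\<close> 0, so cardinality 2 forces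
      finiteness.\<close>
    have f: "card f = 2" "finite f" using assms(4) that card.infinite by force+
    have "(\<Sum>e\<in>M. card (f \<inter> e)) = card (\<Union>e\<in>M. f \<inter> e)"
      using assms(2,3) f(2)
      by (intro card_UN_disjoint[symmetric]) (auto simp: pairwise_def disjnt_def)
    also have "\<dots> \<le> card f" using f(2) by (intro card_mono) auto
    finally show ?thesis using f(1) by simp
  qed
  have "(\<Sum>e\<in>M. charge w G e) = (\<Sum>f\<in>G. w f * (\<Sum>e\<in>M. card (f \<inter> e)) / 2)"
    unfolding charge_def
    by (subst sum.swap) (simp add: sum_distrib_left sum_divide_distrib)
  also have "\<dots> \<le> (\<Sum>f\<in>G. w f)"
  proof (rule sum_mono)
    fix f assume "f \<in> G"
    have "real (\<Sum>e\<in>M. card (f \<inter> e)) \<le> 2" using *[OF \<open>f \<in> G\<close>] by linarith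
    from mult_left_mono[OF this, of "w f"] show "w f * real (\<Sum>e\<in>M. card (f \<inter> e)) / 2 \<le> w f"
      using assms(4) \<open>f \<in> G\<close> by simp
  qed
  finally show ?thesis .
qed

lemma expected_charge_ge:
  fixes w :: "'a set \<Rightarrow> real"
  assumes "0 \<le> p" "p \<le> 1" "finite E" "\<forall>f\<in>E. 0 \<le> w f \<and> card f = 2"
    and "linear_order_on E r" "e \<in> E"
  shows "measure_pmf.expectation (random_subset p E)
      (\<lambda>K. charge w (greedy_matching (processing_order w r K)) e) \<ge> min p (1/2) * w e"
proof -
  define c where "c K = charge w (greedy_matching (processing_order w r K)) e" for K
  have E: "E = insert e (E - {e})" "finite (E - {e})" using assms by auto
  have G: "greedy_matching (processing_order w r K) \<subseteq> E" if "K \<subseteq> E" for K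
    using matching_greedy[OF assms(3,5) that] that by (auto simp: matching_def)
  have finG: "finite (greedy_matching (processing_order w r K))" if "K \<subseteq> E" for K
    using G[OF that] assms(3) finite_subset by blast
  have nn: "\<forall>f\<in>greedy_matching (processing_order w r K). 0 \<le> w f" if "K \<subseteq> E" for K
    using G[OF that] assms(4) by auto
  have e: "0 \<le> w e" "card e = 2" "finite e" using assms(4,6) card.infinite by force+
  \<comment> \<open>Here \<open>X\<close> is the sample outside \<open>e\<close>, and the right-hand
    side averages over the coin of \<open>e\<close>.\<close>
  have point: "min p (1/2) * w e \<le> p * c (insert e X) + (1 - p) * c X" if "X \<subseteq> E - {e}" for X
  proof -
    have sub: "insert e X \<subseteq> E" "X \<subseteq> E" "e \<notin> X" using that assms(6) by auto
    have c0: "0 \<le> c X" unfolding c_def using nn[OF sub(2)] by (rule charge_nonneg)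
    from greedy_dichotomy[OF assms(3,5) sub(1,3), of w] consider
      "e \<in> greedy_matching (processing_order w r (insert e X))" |
      f where "f \<in> greedy_matching (processing_order w r (insert e X))"
        "f \<in> greedy_matching (processing_order w r X)" "f \<inter> e \<noteq> {}" "precedes w r f e" by auto
    then show ?thesis
    proof cases
      case 1
      \<comment> \<open>About the run without \<open>e\<close> only \<open>0 \<le> c X\<close> is
        used; the full weight comes with the factor \<open>p\<close> from the coin of
        \<open>e\<close>.\<close>
      from charge_ge[OF finG nn this, OF sub(1) sub(1), of e] have "w e \<le> c (insert e X)"
        using e by (simp add: c_def)
      then have "p * w e \<le> p * c (insert e X) + (1 - p) * c X"
        using assms(1,2) c0 mult_left_mono[of "w e" "c (insert e X)" p]
          mult_nonneg_nonneg[of "1 - p" "c X"] by linarith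
      moreover have "min p (1/2) * w e \<le> p * w e" using e by (intro mult_right_mono) auto
      ultimately show ?thesis by linarith
    next
      case (2 f)
      have "f \<in> E" using 2(1) G[OF sub(1)] by auto
      then have f: "0 \<le> w f" using assms(4) by auto
      \<comment> \<open>One common vertex already yields half of \<open>w f\<close>, and
        \<open>w f\<close> is at least \<open>w e\<close> because \<open>f\<close> precedes
        \<open>e\<close>. Since \<open>f\<close> is chosen in both runs, \<open>w e / 2\<close> is
        collected however the coin falls.\<close>
      have "1 \<le> card (f \<inter> e)" using 2(3) e(3) by (simp add: Suc_le_eq card_gt_0_iff)
      then have "w f * 1 \<le> w f * card (f \<inter> e)" using f by (intro mult_left_mono) auto
      moreover have "w e \<le> w f" using 2(4) by (auto simp: precedes_def)
      ultimately have half: "w e / 2 \<le> w f * card (f \<inter> e) / 2" by linarith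
      have "w e / 2 \<le> c (insert e X)" "w e / 2 \<le> c X"
        using half charge_ge[OF finG nn 2(1), OF sub(1) sub(1), of e]
          charge_ge[OF finG nn 2(2), OF sub(2) sub(2), of e] by (simp_all add: c_def)
      then have "p * (w e / 2) + (1 - p) * (w e / 2) \<le> p * c (insert e X) + (1 - p) * c X"
        using assms(1,2) by (intro add_mono mult_left_mono) auto
      moreover have "min p (1/2) * w e \<le> 1/2 * w e" using e by (intro mult_right_mono) auto
      moreover have "p * (w e / 2) + (1 - p) * (w e / 2) = 1/2 * w e" by (simp add: field_simps)
      ultimately show ?thesis by linarith
    qed
  qed
  have "min p (1/2) * w e =
      measure_pmf.expectation (random_subset p (E - {e})) (\<lambda>_. min p (1/2) * w e)" by simp
  also have "\<dots> \<le> measure_pmf.expectation (random_subset p (E - {e}))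
      (\<lambda>X. p * c (insert e X) + (1 - p) * c X)"
    by (rule random_subset_expectation_mono[OF E(2) point])
  also have "\<dots> = measure_pmf.expectation (random_subset p E) c"
    using random_subset_expectation_insert[OF E(2) _ assms(1,2), of e c] E(1) by simp
  finally show ?thesis by (simp add: c_def[abs_def])
qed

section \<open>The optimum and the lower bound\<close>

lemma finite_matching_weights:
  fixes w :: "'a set \<Rightarrow> real"
  shows "finite E \<Longrightarrow> finite {sum w M | M. matching E M}"
  by (rule finite_subset[of _ "sum w ` Pow E"]) (auto simp: matching_def)

lemma OPT_ge: "finite E \<Longrightarrow> matching E M \<Longrightarrow> sum w M \<le> OPT w E"
  unfolding OPT_def by (rule Max_ge[OF finite_matching_weights]) auto

lemma OPT_attained:
  assumes "finite E"
  obtains M where "matching E M" "sum w M = OPT w E"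
proof -
  have "matching E {}" by (simp add: matching_def)
  then have "{sum w M | M. matching E M} \<noteq> {}" by blast
  from Max_in[OF finite_matching_weights[OF assms] this] show ?thesis
    using that by (auto simp: OPT_def)
qed

lemma finite_graph_finite_edges: "finite_graph V E \<Longrightarrow> finite E"
  by (rule finite_subset[of _ "Pow V"]) (auto simp: finite_graph_def)

text \<open>Linearity of expectation over an optimal matching reduces the bound to single edges; for
  every sample, the charges of these edges add up to at most the greedy weight.\<close>

lemma expected_greedy_ge:
  fixes w :: "'a set \<Rightarrow> real"
  assumes p: "0 \<le> p" "p \<le> 1" and G: "finite_graph V E" and w: "\<forall>e\<in>E. 0 \<le> w e"
    and r: "linear_order_on E r"
  shows "measure_pmf.expectation (random_subset p E) (Greedy w r) \<ge> min p (1/2) * OPT w E"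
proof -
  have fin: "finite E" using G by (rule finite_graph_finite_edges)
  have w2: "\<forall>e\<in>E. 0 \<le> w e \<and> card e = 2" using G w by (simp add: finite_graph_def)
  obtain M where M: "matching E M" "sum w M = OPT w E" using OPT_attained[OF fin] .
  have M': "M \<subseteq> E" "finite M" "pairwise disjnt M"
    using M(1) fin finite_subset by (auto simp: matching_def)
  have "min p (1/2) * OPT w E = (\<Sum>e\<in>M. min p (1/2) * w e)"
    by (simp add: sum_distrib_left flip: M(2))
  also have "\<dots> \<le> (\<Sum>e\<in>M. measure_pmf.expectation (random_subset p E)
      (\<lambda>K. charge w (greedy_matching (processing_order w r K)) e))"
    using M'(1) by (intro sum_mono expected_charge_ge[OF p fin w2 r]) auto
  also have "\<dots> = measure_pmf.expectation (random_subset p E)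
      (\<lambda>K. \<Sum>e\<in>M. charge w (greedy_matching (processing_order w r K)) e)"
    using fin by (simp add: Bochner_Integration.integral_sum)
  also have "\<dots> \<le> measure_pmf.expectation (random_subset p E) (Greedy w r)"
  proof (rule random_subset_expectation_mono[OF fin])
    fix K assume "K \<subseteq> E"
    then have "greedy_matching (processing_order w r K) \<subseteq> E"
      using matching_greedy[OF fin r] by (auto simp: matching_def)
    then show "(\<Sum>e\<in>M. charge w (greedy_matching (processing_order w r K)) e) \<le> Greedy w r K"
      unfolding Greedy_def using w2 fin finite_subset M' by (intro sum_charge_le) auto
  qed
  finally show ?thesis .
qed

section \<open>The bipartite graph with pendant edges\<close>

text \<open>The vertices \<open>4 i\<close> and \<open>4 j + 1\<close> form the two sides of the complete bipartite graph; their
  pendant neighbours are \<open>4 i + 3\<close> and \<open>4 j + 2\<close>, so that parity is a bipartition.\<close>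

definition mid_edge :: "nat \<Rightarrow> nat \<Rightarrow> nat set" where
  "mid_edge i j = {4 * i, 4 * j + 1}"

definition left_edge :: "nat \<Rightarrow> nat set" where
  "left_edge i = {4 * i, 4 * i + 3}"

definition right_edge :: "nat \<Rightarrow> nat set" where
  "right_edge i = {4 * i + 1, 4 * i + 2}"

lemma mid_edge_eq [simp]: "mid_edge i j = mid_edge i' j' \<longleftrightarrow> i = i' \<and> j = j'"
  unfolding mid_edge_def doubleton_eq_iff by presburger

lemma left_edge_eq [simp]: "left_edge i = left_edge j \<longleftrightarrow> i = j"
  unfolding left_edge_def doubleton_eq_iff by presburger

lemma right_edge_eq [simp]: "right_edge i = right_edge j \<longleftrightarrow> i = j"
  unfolding right_edge_def doubleton_eq_iff by presburger

lemma edge_kinds_neq [simp]: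
  "mid_edge i j \<noteq> left_edge k" "mid_edge i j \<noteq> right_edge k" "left_edge i \<noteq> right_edge k"
  "left_edge k \<noteq> mid_edge i j" "right_edge k \<noteq> mid_edge i j" "right_edge k \<noteq> left_edge i"
  unfolding mid_edge_def left_edge_def right_edge_def doubleton_eq_iff by presburger+

lemma residues_mod_4_neq:
  fixes i j :: nat
  shows "4 * i \<noteq> Suc (4 * j)" "4 * i \<noteq> 4 * j + 2" "4 * i \<noteq> 4 * j + 3"
    "Suc (4 * i) \<noteq> 4 * j" "Suc (4 * i) \<noteq> 4 * j + 2" "Suc (4 * i) \<noteq> 4 * j + 3"
    "4 * i + 2 \<noteq> 4 * j" "4 * i + 3 \<noteq> 4 * j" "4 * i + 3 \<noteq> 4 * j + 2" "4 * i + 3 \<noteq> Suc (4 * j)"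
  by presburger+

lemma disjnt_edges:
  "disjnt (mid_edge i j) (mid_edge i' j') \<longleftrightarrow> i \<noteq> i' \<and> j \<noteq> j'"
  "disjnt (mid_edge i j) (left_edge k) \<longleftrightarrow> i \<noteq> k"
  "disjnt (mid_edge i j) (right_edge k) \<longleftrightarrow> j \<noteq> k"
  "disjnt (left_edge i) (left_edge k) \<longleftrightarrow> i \<noteq> k"
  "disjnt (right_edge i) (right_edge k) \<longleftrightarrow> i \<noteq> k"
  "disjnt (left_edge i) (right_edge k)"
  using residues_mod_4_neq by (auto simp: disjnt_def mid_edge_def left_edge_def right_edge_def)

definition mids :: "nat \<Rightarrow> nat set set" where
  "mids n = case_prod mid_edge ` ({..<n} \<times> {..<n})"

definition outers :: "nat \<Rightarrow> nat set set" where
  "outers n = left_edge ` {..<n} \<union> right_edge ` {..<n}"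

definition pendant_edges :: "nat \<Rightarrow> nat set set" where
  "pendant_edges n = mids n \<union> outers n"

text \<open>For positive \<epsilon> ties occur only within each of the two kinds of edges, so every
  tie-breaking rule processes the \<open>mids\<close> first. This makes the upper bound uniform in
  \<open>r\<close>.\<close>

definition pendant_weight :: "nat \<Rightarrow> real \<Rightarrow> nat set \<Rightarrow> real" where
  "pendant_weight n \<epsilon> e = (if e \<in> mids n then 1 + \<epsilon> else 1)"

lemma finite_pendant_edges [simp]: "finite (pendant_edges n)"
  by (simp add: pendant_edges_def mids_def outers_def)

lemma finite_graph_pendant: "finite_graph {..<4 * n} (pendant_edges n)"
  unfolding finite_graph_def
  by (auto simp: pendant_edges_def mids_def outers_def mid_edge_def left_edge_def right_edge_def
      card_insert_if) presburger+

lemma bipartite_pendant: "bipartite {..<4 * n} (pendant_edges n)"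
  unfolding bipartite_def
proof (intro exI conjI ballI)
  let ?X = "{v. v < 4 * n \<and> even v}" and ?Y = "{v. v < 4 * n \<and> odd v}"
  show "?X \<union> ?Y = {..<4 * n}" "?X \<inter> ?Y = {}" by auto
  fix e assume "e \<in> pendant_edges n"
  \<comment> \<open>Every edge is written with its even endpoint first, which swaps the two vertices
    of a right edge.\<close>
  then consider i j where "e = {4 * i, 4 * j + 1}" "i < n" "j < n"
    | i where "e = {4 * i, 4 * i + 3}" "i < n" | i where "e = {4 * i + 2, 4 * i + 1}" "i < n"
    by (auto simp: pendant_edges_def mids_def outers_def mid_edge_def left_edge_def right_edge_def
        insert_commute)
  then show "\<exists>x\<in>?X. \<exists>y\<in>?Y. e = {x, y}"
  proof cases
    case 1
    then show ?thesis by (intro bexI[of _ "4 * i"] bexI[of _ "4 * j + 1"]) auto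
  next
    case 2
    then show ?thesis by (intro bexI[of _ "4 * i"] bexI[of _ "4 * i + 3"]) auto
  next
    case 3
    then show ?thesis by (intro bexI[of _ "4 * i + 2"] bexI[of _ "4 * i + 1"]) auto
  qed
qed

text \<open>The witness is the set of all pendant edges: they are pairwise disjoint, and there are
  \<open>2 * n\<close> of them, each of weight 1.\<close>

lemma OPT_pendant_ge: "2 * real n \<le> OPT (pendant_weight n \<epsilon>) (pendant_edges n)"
proof -
  have "matching (pendant_edges n) (outers n)"
    unfolding matching_def pairwise_def
    by (auto simp: pendant_edges_def outers_def disjnt_edges disjnt_sym)
  then have "sum (pendant_weight n \<epsilon>) (outers n) \<le> OPT (pendant_weight n \<epsilon>) (pendant_edges n)"
    by (intro OPT_ge) auto
  moreover have "card (outers n) = 2 * n"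
    unfolding outers_def by (subst card_Un_disjoint) (auto simp: card_image inj_on_def)
  moreover have "sum (pendant_weight n \<epsilon>) (outers n) = card (outers n)"
    unfolding pendant_weight_def by (subst sum.cong[of _ _ _ "\<lambda>_. 1"]) (auto simp: mids_def outers_def)
  ultimately show ?thesis by simp
qed

section \<open>The greedy weight on the pendant graph\<close>

text \<open>The sets \<open>A\<close> and \<open>B\<close> index the inner vertices missed by the
  chosen mid edges. Their sizes agree because each mid edge uses one vertex per side, and only these
  vertices can carry a chosen pendant edge.\<close>

lemma uncovered_mids:
  assumes K: "K \<subseteq> pendant_edges n" and r: "linear_order_on (pendant_edges n) r" and \<epsilon>: "0 < \<epsilon>"
  obtains A B where "A \<subseteq> {..<n}" "B \<subseteq> {..<n}" "card A = card B"
    "K \<inter> case_prod mid_edge ` (A \<times> B) = {}"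
    "Greedy (pendant_weight n \<epsilon>) r K \<le> (1 + \<epsilon>) * n + 2 * card A"
proof
  define G where "G = greedy_matching (processing_order (pendant_weight n \<epsilon>) r K)"
  have G: "G \<subseteq> K" "pairwise disjnt G"
    using matching_greedy[OF finite_pendant_edges r K] by (auto simp: G_def matching_def)
  define P where "P = {(i, j). i < n \<and> j < n \<and> mid_edge i j \<in> G}"
  define A where "A = {..<n} - fst ` P"
  define B where "B = {..<n} - snd ` P"
  show "A \<subseteq> {..<n}" "B \<subseteq> {..<n}" by (auto simp: A_def B_def)
  have dis: "e = f" if "e \<in> G" "f \<in> G" "\<not> disjnt e f" for e f
    using that G(2) by (auto simp: pairwise_def)
  have P: "finite P" "fst ` P \<subseteq> {..<n}" "snd ` P \<subseteq> {..<n}"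
    by (auto simp: P_def intro: finite_subset[of _ "{..<n} \<times> {..<n}"])
  \<comment> \<open>Two chosen mid edges with a common coordinate would meet, so both projections of
    \<open>P\<close> are injective.\<close>
  have "inj_on fst P" "inj_on snd P"
    using dis by (auto simp: P_def inj_on_def disjnt_edges) (metis disjnt_edges(1) mid_edge_eq)+
  then have card: "card A = n - card P" "card B = n - card P" "card P \<le> n"
    using P card_mono[OF _ P(2)] unfolding A_def B_def
    by (simp_all add: card_Diff_subset card_image)
  then show "card A = card B" by simp
  show "K \<inter> case_prod mid_edge ` (A \<times> B) = {}"
  proof (intro equalityI subsetI, safe)
    fix i j assume ij: "mid_edge i j \<in> K" "i \<in> A" "j \<in> B"
    from ij(2,3) have lt: "i < n" "j < n" by (auto simp: A_def B_def)
    then have "mid_edge i j \<in> mids n" by (auto simp: mids_def)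
    moreover have "mid_edge i j \<notin> G" using ij(2) lt by (force simp: A_def P_def)
    ultimately obtain f where f: "f \<in> G" "f \<inter> mid_edge i j \<noteq> {}"
      "precedes (pendant_weight n \<epsilon>) r f (mid_edge i j)" "mid_edge i j \<in> mids n"
      using greedy_maximal[OF finite_pendant_edges r K ij(1), of "pendant_weight n \<epsilon>"]
      unfolding G_def by blast
    \<comment> \<open>The blocking edge weighs at least 1 + \<epsilon>, so it is itself a mid edge
      and covers \<open>i\<close> or \<open>j\<close>, contrary to the choice of \<open>A\<close>
      and \<open>B\<close>.\<close>
    then obtain i' j' where f': "f = mid_edge i' j'" "i' < n" "j' < n"
      using \<epsilon> by (auto simp: precedes_def pendant_weight_def mids_def split: if_splits)
    then have "(i', j') \<in> P" using f(1) by (auto simp: P_def)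
    then have "i' \<in> fst ` P" "j' \<in> snd ` P" by force+
    moreover have "i = i' \<or> j = j'"
      using f(2) disjnt_edges(1)[of i' j' i j] by (auto simp: f' disjnt_def)
    ultimately show "mid_edge i j \<in> {}" using ij(2,3) by (auto simp: A_def B_def)
  qed
  \<comment> \<open>A chosen pendant edge shares its inner vertex with no chosen mid edge, so it is
    attached at \<open>A\<close> or \<open>B\<close>.\<close>
  have sub: "G \<subseteq> case_prod mid_edge ` P \<union> left_edge ` A \<union> right_edge ` B"
  proof
    fix e assume e: "e \<in> G"
    then have "e \<in> pendant_edges n" using G K by auto
    then consider i j where "e = mid_edge i j" "i < n" "j < n"
      | i where "e = left_edge i" "i < n" | i where "e = right_edge i" "i < n"
      by (auto simp: pendant_edges_def mids_def outers_def)
    then show "e \<in> case_prod mid_edge ` P \<union> left_edge ` A \<union> right_edge ` B"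
    proof cases
      case 1
      then show ?thesis using e by (force simp: P_def)
    next
      case 2
      then have "mid_edge i b \<notin> G" for b
        using e dis[of "mid_edge i b" "left_edge i"] by (auto simp: disjnt_edges)
      then have "i \<in> A" using 2(2) by (auto simp: A_def P_def)
      then show ?thesis using 2 by auto
    next
      case 3
      then have "mid_edge b i \<notin> G" for b
        using e dis[of "mid_edge b i" "right_edge i"] by (auto simp: disjnt_edges)
      then have "i \<in> B" using 3(2) by (auto simp: B_def P_def)
      then show ?thesis using 3 by auto
    qed
  qed
  have fin: "finite A" "finite B" by (auto simp: A_def B_def)
  let ?w = "pendant_weight n \<epsilon>"
  have w0: "0 \<le> ?w e" for e using \<epsilon> by (simp add: pendant_weight_def)
  have "sum ?w G \<le> sum ?w (case_prod mid_edge ` P \<union> left_edge ` A \<union> right_edge ` B)"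
    using sub fin P w0 by (intro sum_mono2) auto
  also have "\<dots> = sum ?w (case_prod mid_edge ` P) + sum ?w (left_edge ` A) + sum ?w (right_edge ` B)"
  proof -
    have "case_prod mid_edge ` P \<inter> left_edge ` A = {}"
      "(case_prod mid_edge ` P \<union> left_edge ` A) \<inter> right_edge ` B = {}" by auto
    then show ?thesis using fin P by (simp add: sum.union_disjoint)
  qed
  also have "sum ?w (case_prod mid_edge ` P) = (\<Sum>e\<in>case_prod mid_edge ` P. 1 + \<epsilon>)"
    by (intro sum.cong) (auto simp: pendant_weight_def mids_def P_def)
  also have "\<dots> = (1 + \<epsilon>) * card P"
  proof -
    have "inj_on (case_prod mid_edge) P" by (auto simp: inj_on_def)
    then show ?thesis by (simp add: card_image)
  qed
  also have "sum ?w (left_edge ` A) = (\<Sum>e\<in>left_edge ` A. 1)"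
    by (intro sum.cong) (auto simp: pendant_weight_def mids_def)
  also have "\<dots> = card A" by (simp add: card_image inj_on_def)
  also have "sum ?w (right_edge ` B) = (\<Sum>e\<in>right_edge ` B. 1)"
    by (intro sum.cong) (auto simp: pendant_weight_def mids_def)
  also have "\<dots> = card B" by (simp add: card_image inj_on_def)
  also have "(1 + \<epsilon>) * card P + real (card A) + card B \<le> (1 + \<epsilon>) * n + 2 * card A"
    using card \<epsilon> mult_left_mono[of "real (card P)" n "1 + \<epsilon>"] by simp
  finally show "Greedy ?w r K \<le> (1 + \<epsilon>) * n + 2 * card A"
    by (simp add: Greedy_def G_def)
qed

text \<open>If fewer than \<open>s\<close> vertices per side stay uncovered, the pendant edges add
  at most \<open>2 * s\<close>. Otherwise two large sets span no sampled edge; a union bound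
  controls this event, on which the trivial value \<open>2 * n\<close> is paid. The threshold
  \<open>s\<close> is left free.\<close>

lemma expected_greedy_pendant_le:
  assumes p: "0 \<le> p" "p \<le> 1" and r: "linear_order_on (pendant_edges n) r" and \<epsilon>: "0 < \<epsilon>"
  shows "measure_pmf.expectation (random_subset p (pendant_edges n)) (Greedy (pendant_weight n \<epsilon>) r)
    \<le> (1 + \<epsilon>) * n + 2 * s + 2 * n * (4 ^ n * (1 - p) ^ (s * s))"
proof -
  \<comment> \<open>Admitting all sizes from \<open>s\<close> upwards puts the uncovered pair itself
    into \<open>S\<close>, and the number of pairs is still at most \<open>4 ^ n\<close>.\<close>
  define S where "S = {(A, B). A \<subseteq> {..<n} \<and> B \<subseteq> {..<n} \<and> s \<le> card A \<and> s \<le> card B}"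
  define F where "F = (\<lambda>(A, B). case_prod mid_edge ` (A \<times> B))"
  define I :: "_ \<Rightarrow> _ \<Rightarrow> real" where "I = (\<lambda>AB. indicator {X. X \<inter> F AB = {}})"
  have S: "S \<subseteq> Pow {..<n} \<times> Pow {..<n}" by (auto simp: S_def)
  then have finS: "finite S" by (rule finite_subset) simp
  have "card S \<le> card (Pow {..<n} \<times> Pow {..<n})" using S by (intro card_mono) auto
  then have "card S \<le> 2 ^ n * 2 ^ n" by (simp add: card_Pow)
  then have cardS: "card S \<le> 4 ^ n" by (simp flip: power_mult_distrib)
  have point: "Greedy (pendant_weight n \<epsilon>) r K \<le> (1 + \<epsilon>) * n + 2 * s + 2 * n * (\<Sum>AB\<in>S. I AB K)"
    if K: "K \<subseteq> pendant_edges n" for K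
  proof -
    obtain A B where AB: "A \<subseteq> {..<n}" "B \<subseteq> {..<n}" "card A = card B"
      "K \<inter> case_prod mid_edge ` (A \<times> B) = {}"
      "Greedy (pendant_weight n \<epsilon>) r K \<le> (1 + \<epsilon>) * n + 2 * card A"
      using uncovered_mids[OF K r \<epsilon>] by blast
    have nn: "0 \<le> (\<Sum>AB\<in>S. I AB K)" by (intro sum_nonneg) (auto simp: I_def)
    show ?thesis
    proof (cases "card A < s")
      case True
      have "0 \<le> 2 * n * (\<Sum>AB\<in>S. I AB K)" using nn by simp
      then show ?thesis using AB(5) True by linarith
    next
      case False
      \<comment> \<open>The indicator of this pair is 1 on \<open>K\<close>, so the sum is at least
        1 and its coefficient \<open>2 * n\<close> dominates \<open>2 * card A\<close>.\<close>
      then have "(A, B) \<in> S" using AB by (auto simp: S_def)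
      then have "I (A, B) K \<le> (\<Sum>AB\<in>S. I AB K)"
        using finS by (intro member_le_sum) (auto simp: I_def)
      moreover have "I (A, B) K = 1" using AB(4) by (simp add: I_def F_def)
      ultimately have "2 * real n \<le> 2 * n * (\<Sum>AB\<in>S. I AB K)"
        using mult_left_mono[of 1 "\<Sum>AB\<in>S. I AB K" "2 * real n"] by simp
      moreover have "card A \<le> n" using card_mono[OF _ AB(1)] by simp
      ultimately show ?thesis using AB(5) by linarith
    qed
  qed
  have prob: "measure_pmf.expectation (random_subset p (pendant_edges n)) (I AB) \<le> (1 - p) ^ (s * s)"
    if ABS: "AB \<in> S" for AB
  proof -
    obtain A B where AB: "AB = (A, B)" "A \<subseteq> {..<n}" "B \<subseteq> {..<n}" "s \<le> card A" "s \<le> card B"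
      using ABS by (cases AB) (auto simp: S_def)
    have "measure_pmf.expectation (random_subset p (pendant_edges n)) (I AB) =
        (1 - p) ^ card (F AB)"
    proof -
      have "F AB \<subseteq> pendant_edges n" using AB by (auto simp: F_def pendant_edges_def mids_def)
      then show ?thesis using p by (simp add: I_def prob_random_subset_disjoint)
    qed
    also have "card (F AB) = card A * card B"
      by (simp add: F_def AB(1) card_image inj_on_def card_cartesian_product)
    also have "(1 - p) ^ (card A * card B) \<le> (1 - p) ^ (s * s)"
      using p AB by (intro power_decreasing mult_le_mono) auto
    finally show ?thesis .
  qed
  have "measure_pmf.expectation (random_subset p (pendant_edges n)) (Greedy (pendant_weight n \<epsilon>) r)
      \<le> measure_pmf.expectation (random_subset p (pendant_edges n))
          (\<lambda>K. (1 + \<epsilon>) * n + 2 * s + 2 * n * (\<Sum>AB\<in>S. I AB K))"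
    using point by (rule random_subset_expectation_mono[OF finite_pendant_edges])
  also have "\<dots> = (1 + \<epsilon>) * n + 2 * s + 2 * n *
      (\<Sum>AB\<in>S. measure_pmf.expectation (random_subset p (pendant_edges n)) (I AB))"
    by (simp add: Bochner_Integration.integral_sum)
  also have "\<dots> \<le> (1 + \<epsilon>) * n + 2 * s + 2 * n * (card S * (1 - p) ^ (s * s))"
    using sum_bounded_above[OF prob] by (intro add_left_mono mult_left_mono) auto
  also have "\<dots> \<le> (1 + \<epsilon>) * n + 2 * s + 2 * n * (4 ^ n * (1 - p) ^ (s * s))"
  proof -
    have "real (card S) \<le> 4 ^ n" using cardS by (metis of_nat_le_iff of_nat_numeral of_nat_power)
    then show ?thesis using p by (intro add_left_mono mult_left_mono mult_right_mono) auto
  qed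
  finally show ?thesis by simp
qed

section \<open>The two ranges of the probability and the limit\<close>

text \<open>Greedy collects the only edge exactly when it is sampled. The ratio therefore equals
  \<open>p\<close> for each instance, and a constant sequence of graphs will do.\<close>

lemma sparse_tight:
  assumes p: "0 \<le> p" "p \<le> 1/2"
  shows "\<exists>(V :: nat set) E w. finite_graph V E \<and> bipartite V E \<and> (\<forall>e\<in>E. 0 \<le> w e) \<and>
    0 < OPT w E \<and> (\<forall>r. linear_order_on E r \<longrightarrow>
      measure_pmf.expectation (random_subset p E) (Greedy w r) / OPT w E = min p (1/2))"
proof (intro exI conjI allI impI)
  let ?V = "{0, 1 :: nat}" and ?w = "\<lambda>_ :: nat set. 1 :: real"
  let ?E = "{?V}"
  show "finite_graph ?V ?E" "\<forall>e\<in>?E. 0 \<le> ?w e" by (auto simp: finite_graph_def)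
  show "bipartite ?V ?E" unfolding bipartite_def
    by (intro exI[of _ "{0}"] exI[of _ "{1}"]) auto
  have "{sum ?w M | M. matching ?E M} = {0, 1}"
    by (auto simp: matching_def subset_singleton_iff intro: exI[of _ "{}"] exI[of _ ?E])
  then have OPT: "OPT ?w ?E = 1" by (simp add: OPT_def)
  then show "0 < OPT ?w ?E" by simp
  fix r assume r: "linear_order_on ?E r"
  have "Greedy ?w r {} = 0" "Greedy ?w r ?E = 1"
    using processing_order_eqI[OF _ r, of "{}" "[]" ?w] processing_order_eqI[OF _ r, of ?E "[?V]" ?w]
    by (simp_all add: Greedy_def greedy_matching_def)
  moreover have "random_subset p {} = return_pmf ({} :: nat set set)"
    by (simp add: random_subset_def)
  ultimately have "measure_pmf.expectation (random_subset p ?E) (Greedy ?w r) = p"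
    using p random_subset_expectation_insert[of "{}" ?V p "Greedy ?w r"] by simp
  then show "measure_pmf.expectation (random_subset p ?E) (Greedy ?w r) / OPT ?w ?E = min p (1/2)"
    using p OPT by simp
qed

text \<open>With \<open>s = 2 * m\<close> the exponent \<open>s * s\<close> is \<open>4 * n\<close>,
  and 1 - p is at most 1/2, so the failure probability of a pair is at most
  \<open>(1/16) ^ n\<close>, which beats the \<open>4 ^ n\<close> pairs. Relative to
  \<open>2 * n\<close>, the excess weight costs 1/(2m) and the uncovered vertices cost 2/m, together
  at most 3/m.\<close>

lemma dense_ratio_le:
  assumes p: "1/2 \<le> p" "p \<le> 1" and r: "linear_order_on (pendant_edges n) r"
    and n: "n = m * m" and m: "0 < m"
  shows "measure_pmf.expectation (random_subset p (pendant_edges n)) (Greedy (pendant_weight n (1 / m)) r)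
      / OPT (pendant_weight n (1 / m)) (pendant_edges n) \<le> 1/2 + 3 / m + (1/4) ^ m"
    (is "?G / ?O \<le> _")
proof -
  have n0: "0 < n" using n m by simp
  have "(1 - p) ^ (2 * m * (2 * m)) \<le> (1/2) ^ (2 * m * (2 * m))" using p by (intro power_mono) auto
  also have "\<dots> = (1/16) ^ n"
    using power_mult[of "1/2 :: real" 4 n] by (simp add: n power_divide algebra_simps)
  finally have "4 ^ n * (1 - p) ^ (2 * m * (2 * m)) \<le> 4 ^ n * (1/16) ^ n" by (intro mult_left_mono) auto
  also have "\<dots> = (1/4 :: real) ^ n" by (simp flip: power_mult_distrib)
  also have "\<dots> \<le> (1/4) ^ m" using n by (intro power_decreasing) auto
  finally have small: "4 ^ n * (1 - p) ^ (2 * m * (2 * m)) \<le> (1/4) ^ m" .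
  have "0 \<le> p" using p by simp
  have "?G \<le> (1 + 1 / m) * n + 2 * (2 * m) + 2 * n * (4 ^ n * (1 - p) ^ (2 * m * (2 * m)))"
    using expected_greedy_pendant_le[OF \<open>0 \<le> p\<close> p(2) r, of "1 / m" "2 * m"] m by simp
  also have "\<dots> \<le> (1 + 1 / m) * n + 2 * (2 * m) + 2 * n * (1/4) ^ m"
    using small by (intro add_left_mono mult_left_mono) auto
  also have "\<dots> \<le> (1/2 + 3 / m + (1/4) ^ m) * (2 * n)"
    using m unfolding n by (simp add: field_simps)
  also have "\<dots> \<le> (1/2 + 3 / m + (1/4) ^ m) * ?O"
    using OPT_pendant_ge[of n "1 / m"] by (intro mult_left_mono) auto
  finally show ?thesis using OPT_pendant_ge[of n "1 / m"] n0 by (simp add: pos_divide_le_eq)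
qed

theorem lemma5p7:
  fixes p :: real
  assumes "0 \<le> p" and "p \<le> 1"
  shows "(\<forall>(V :: 'a set) E w r.
            finite_graph V E \<longrightarrow> (\<forall>e\<in>E. 0 \<le> w e) \<longrightarrow> linear_order_on E r \<longrightarrow>
            measure_pmf.expectation (random_subset p E) (\<lambda>E'. Greedy w r E')
              \<ge> min p (1/2) * OPT w E)
       \<and> (\<exists>(V :: nat \<Rightarrow> nat set) E w.
            (\<forall>k. finite_graph (V k) (E k) \<and> bipartite (V k) (E k) \<and>
                 (\<forall>e\<in>E k. 0 \<le> w k e) \<and> 0 < OPT (w k) (E k)) \<and>
            (\<forall>r. (\<forall>k. linear_order_on (E k) (r k)) \<longrightarrow>
                 (\<lambda>k. measure_pmf.expectation (random_subset p (E k)) (\<lambda>E'. Greedy (w k) (r k) E')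
                        / OPT (w k) (E k))
                   \<longlonglongrightarrow> min p (1/2)))"
proof (intro conjI allI impI)
  fix V :: "'a set" and E r and w :: "'a set \<Rightarrow> real"
  assume "finite_graph V E" "\<forall>e\<in>E. 0 \<le> w e" "linear_order_on E r"
  then show "measure_pmf.expectation (random_subset p E) (\<lambda>E'. Greedy w r E')
      \<ge> min p (1/2) * OPT w E"
    by (rule expected_greedy_ge[OF assms])
next
  show "\<exists>(V :: nat \<Rightarrow> nat set) E w.
            (\<forall>k. finite_graph (V k) (E k) \<and> bipartite (V k) (E k) \<and>
                 (\<forall>e\<in>E k. 0 \<le> w k e) \<and> 0 < OPT (w k) (E k)) \<and>
            (\<forall>r. (\<forall>k. linear_order_on (E k) (r k)) \<longrightarrow>
                 (\<lambda>k. measure_pmf.expectation (random_subset p (E k)) (\<lambda>E'. Greedy (w k) (r k) E')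
                        / OPT (w k) (E k))
                   \<longlonglongrightarrow> min p (1/2))"
  proof (cases "p \<le> 1/2")
    case True
    from sparse_tight[OF assms(1) True] obtain V :: "nat set" and E and w :: "nat set \<Rightarrow> real" where
      *: "finite_graph V E \<and> bipartite V E \<and> (\<forall>e\<in>E. 0 \<le> w e) \<and> 0 < OPT w E"
        "\<forall>r. linear_order_on E r \<longrightarrow>
          measure_pmf.expectation (random_subset p E) (Greedy w r) / OPT w E = min p (1/2)"
      by blast
    then show ?thesis
      by (intro exI[of _ "\<lambda>_. V"] exI[of _ "\<lambda>_. E"] exI[of _ "\<lambda>_. w"]) simp
  next
    case False
    then have p: "1/2 \<le> p" by simp
    \<comment> \<open>Squares \<open>m * m\<close> with \<open>m = Suc k\<close> keep
      \<open>m\<close> positive, and the error terms in \<open>m\<close> tend to 0.\<close>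
    define N where "N k = Suc k * Suc k" for k
    define w where "w k = pendant_weight (N k) (1 / Suc k)" for k
    have w0: "\<forall>e\<in>pendant_edges (N k). 0 \<le> w k e" for k by (simp add: w_def pendant_weight_def)
    have OPT: "0 < OPT (w k) (pendant_edges (N k))" for k
    proof -
      have "0 < 2 * real (N k)" unfolding N_def by (simp del: mult_Suc mult_Suc_right)
      then show ?thesis unfolding w_def using OPT_pendant_ge by (rule less_le_trans)
    qed
    have "(\<lambda>k. measure_pmf.expectation (random_subset p (pendant_edges (N k)))
        (\<lambda>E'. Greedy (w k) (r k) E') / OPT (w k) (pendant_edges (N k))) \<longlonglongrightarrow> min p (1/2)"
      (is "?R \<longlonglongrightarrow> _") if r: "\<forall>k. linear_order_on (pendant_edges (N k)) (r k)" for r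
    proof (rule tendsto_sandwich)
      \<comment> \<open>The lower side of the sandwich is the general lower bound applied to these
        graphs, divided by the positive optimum.\<close>
      show "\<forall>\<^sub>F k in sequentially. min p (1/2) \<le> ?R k"
      proof (intro always_eventually allI)
        fix k
        show "min p (1/2) \<le> ?R k"
          using expected_greedy_ge[OF assms finite_graph_pendant w0 r[rule_format]] OPT[of k]
          by (simp add: pos_le_divide_eq)
      qed
      show "\<forall>\<^sub>F k in sequentially. ?R k \<le> 1/2 + 3 / Suc k + (1/4) ^ Suc k"
        using dense_ratio_le[OF p assms(2) r[rule_format] N_def]
        by (intro always_eventually) (simp add: w_def)
      have "(\<lambda>k. 1/2 + 3 / real (Suc k) + (1/4) ^ Suc k) \<longlonglongrightarrow> 1/2 + 0 + 0"
        by (intro tendsto_add tendsto_const LIMSEQ_Suc[OF lim_const_over_n]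
            LIMSEQ_Suc[OF LIMSEQ_realpow_zero]) auto
      then show "(\<lambda>k. 1/2 + 3 / real (Suc k) + (1/4) ^ Suc k) \<longlonglongrightarrow> min p (1/2)"
        using p by simp
    qed simp
    then show ?thesis using finite_graph_pendant bipartite_pendant w0 OPT
      by (intro exI[of _ "\<lambda>k. {..<4 * N k}"] exI[of _ "\<lambda>k. pendant_edges (N k)"] exI[of _ w]) blast
  qed
qed

end
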